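(* Let $R>0$. Over the local regime $r_1^2+r_2^2\le\min\{R_{c^1}^2,R_{c^2}^2\}$, $$\sup_{\substack{r_1,r_2\in[0,R],\ \theta\in[0,2\pi)\\ r_1^2+r_2^2\le\min\{R_{c^1}^2,R_{c^2}^2\}}}\sigma^2_{\mathcal{E}}(r_1,r_2,\theta)\ \le\ 2\Big(h(0)-h\big(8r^2\big)\Big),\qquad\text{where } r^2=\min\big(R_{c^1}^2,R_{c^2}^2,R^2\big).$$
   Context: Let $h:[0,\infty)\to\mathbb{R}$ be twice continuously differentiable such that $h\ge0$ and $h''\ge0$ are both monotone decreasing and $h'\le0$ is monotone increasing. (Here $h$ is the function with $k_u(x,y)=h(\|x-y\|_2^2)$ for the covariance of an isotropic mean-zero Gaussian field $u$ on $\mathbb{R}^D\times\mathbb{R}^D$.) Let $\sigma^2_{\mathcal{E}}(r_1,r_2,\theta)$ denote the pointwise variance, in polar form, of the error of the second-order Taylor approximation at $(z^*,z^* )$ of $f(x^{(1)},x^{(2)})=u(x^{(1)},x^{(2)})-u(x^{(2)},x^{(1)})$, evaluated at inputs at distances $r_1,r_2\ge 0$ from $z^*$ with relative angle $\theta$: $$\begin{aligned}\sigma^2_{\mathcal{E}}(r_1,r_2,\theta)={}&2\Big(h(0)-h\big(2(r_1^2+r_2^2-2r_1r_2\cos\theta)\big)\Big)\\&+4\Big(-h'(0)+2h'(r_1^2+r_2^2)\Big)\Big(r_1^2+r_2^2-2r_1r_2\cos\theta\Big)\\&+4\Big(h''(0)-2h''(r_1^2+r_2^2)\Big)\Big((r_1^2+r_2^2)^2-4r_1^2r_2^2\cos^2\theta\Big).\end{aligned}$$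 The critical radii $R_{c^1},R_{c^2}\ge0$ are assumed to exist and are defined by $-h'(0)+2h'(R_{c^1}^2)=0$ and $h''(0)-2h''(R_{c^2}^2)=0$. *)

theory Defs
  imports "HOL-Analysis.Analysis"
begin

text \<open>
  Variance, in polar form, of the error of the second-order Taylor approximation at
  \<open>(z, z)\<close> of \<open>f (x, y) = u (x, y) - u (y, x)\<close>, where \<open>u\<close> is an isotropic mean-zero
  Gaussian field with covariance \<open>h (\<parallel>x - y\<parallel>\<^sup>2)\<close>.  The arguments \<open>h'\<close> and \<open>h''\<close> stand for the
  first two derivatives of \<open>h\<close> on \<open>[0, \<infinity>)\<close>, one-sided at 0; they are passed explicitly because
  \<open>deriv\<close> is two-sided and would make the values at 0 depend on \<open>h\<close> outside \<open>[0, \<infinity>)\<close>.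
\<close>

definition taylor_error_variance ::
    "(real \<Rightarrow> real) \<Rightarrow> (real \<Rightarrow> real) \<Rightarrow> (real \<Rightarrow> real) \<Rightarrow> real \<Rightarrow> real \<Rightarrow> real \<Rightarrow> real" where
  "taylor_error_variance h h' h'' r1 r2 \<theta> =
     2 * (h 0 - h (2 * (r1\<^sup>2 + r2\<^sup>2 - 2 * r1 * r2 * cos \<theta>)))
   + 4 * (- h' 0 + 2 * h' (r1\<^sup>2 + r2\<^sup>2)) * (r1\<^sup>2 + r2\<^sup>2 - 2 * r1 * r2 * cos \<theta>)
   + 4 * (h'' 0 - 2 * h'' (r1\<^sup>2 + r2\<^sup>2)) * ((r1\<^sup>2 + r2\<^sup>2)\<^sup>2 - 4 * r1\<^sup>2 * r2\<^sup>2 * (cos \<theta>)\<^sup>2)"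

end

theory Submission
  imports Defs
begin

text \<open>
  Put \<open>s = r1\<^sup>2 + r2\<^sup>2\<close> and \<open>p = 2 r1 r2 cos \<theta>\<close>.  Since \<open>\<bar>p\<bar> \<le> s\<close>, the squared distance
  \<open>s - p\<close> of the two inputs lies in \<open>[0, 2 s]\<close>, and \<open>s\<^sup>2 - p\<^sup>2 \<ge> 0\<close>.  These are the geometric
  factors of the second and third summands of the variance.  Their
  coefficients \<open>- h' 0 + 2 h' s\<close> and \<open>h'' 0 - 2 h'' s\<close> vanish when \<open>s\<close> is the square of the respective
  critical radius.  Both are increasing in \<open>s\<close>, because \<open>h'\<close> increases and \<open>h''\<close> decreases, hence
  both are nonpositive in the local regime.  The two summands can therefore be dropped, which leaves
  \<open>2 (h 0 - h (2 (s - p)))\<close>.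

  As \<open>h\<close> is decreasing, it remains to bound the argument: \<open>2 (s - p) \<le> 4 s\<close>, while
  \<open>s\<close> is at most the smaller squared critical radius and at most \<open>2 R\<^sup>2\<close>.  The constant \<open>8\<close> is thus
  what opposite inputs at distance \<open>R\<close> force; where a critical radius is the binding constraint,
  \<open>4\<close> would do.
\<close>

text \<open>
  By the law of cosines \<open>r1\<^sup>2 + r2\<^sup>2 - 2 r1 r2 cos \<theta>\<close> and \<open>r1\<^sup>2 + r2\<^sup>2 + 2 r1 r2 cos \<theta>\<close> are the squared
  lengths of the difference and the sum of two planar vectors, so neither is negative.
\<close>

lemma abs_polar_inner_le:
  fixes r1 r2 \<theta> :: real
  shows "\<bar>2 * r1 * r2 * cos \<theta>\<bar> \<le> r1\<^sup>2 + r2\<^sup>2"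
proof -
  have "\<bar>2 * r1 * r2 * cos \<theta>\<bar> = \<bar>2 * r1 * r2\<bar> * \<bar>cos \<theta>\<bar>"
    by (simp add: abs_mult)
  also have "\<dots> \<le> \<bar>2 * r1 * r2\<bar>"
    by (intro mult_right_le_one_le) auto
  also have "\<dots> \<le> r1\<^sup>2 + r2\<^sup>2"
    using sum_squares_bound[of "\<bar>r1\<bar>" "\<bar>r2\<bar>"] by (simp add: abs_mult)
  finally show ?thesis .
qed

text \<open>
  The two sign conditions are what the definition of the critical radii provides; under them the
  correction terms only lower the variance, so it is at most the prior variance of \<open>f\<close>, which,
  for given \<open>r1\<^sup>2 + r2\<^sup>2\<close>, is largest for opposite inputs at equal distance from the centre.
\<close>

lemma taylor_error_variance_le:
  fixes h h' h'' :: "real \<Rightarrow> real" and r1 r2 \<theta> :: real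
  assumes h: "antimono_on {0..} h"
    and first: "- h' 0 + 2 * h' (r1\<^sup>2 + r2\<^sup>2) \<le> 0"
    and second: "h'' 0 - 2 * h'' (r1\<^sup>2 + r2\<^sup>2) \<le> 0"
    and t: "4 * (r1\<^sup>2 + r2\<^sup>2) \<le> t"
  shows "taylor_error_variance h h' h'' r1 r2 \<theta> \<le> 2 * (h 0 - h t)"
proof -
  define s where "s = r1\<^sup>2 + r2\<^sup>2"
  define p where "p = 2 * r1 * r2 * cos \<theta>"
  have p: "\<bar>p\<bar> \<le> s"
    unfolding p_def s_def by (rule abs_polar_inner_le)
  have "p\<^sup>2 \<le> s\<^sup>2"
    using p by (intro abs_le_square_iff[THEN iffD1]) auto
  moreover have "4 * r1\<^sup>2 * r2\<^sup>2 * (cos \<theta>)\<^sup>2 = p\<^sup>2"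
    by (simp add: p_def power_mult_distrib)
  ultimately have "4 * (h'' 0 - 2 * h'' s) * (s\<^sup>2 - 4 * r1\<^sup>2 * r2\<^sup>2 * (cos \<theta>)\<^sup>2) \<le> 0"
    using second by (intro mult_nonpos_nonneg[of "4 * _"]) (simp_all add: s_def)
  moreover have "4 * (- h' 0 + 2 * h' s) * (s - p) \<le> 0"
    using first p by (intro mult_nonpos_nonneg[of "4 * _"]) (simp_all add: s_def)
  moreover have "h t \<le> h (2 * (s - p))"
    using p t by (intro monotone_onD[OF h]) (auto simp: s_def)
  ultimately show ?thesis
    unfolding taylor_error_variance_def s_def p_def by (intro add_decreasing2) simp_all
qed

theorem proposition33:
  fixes h h' h'' :: "real \<Rightarrow> real" and R Rc1 Rc2 :: real
  assumes deriv_h: "\<And>x. x \<ge> 0 \<Longrightarrow> (h has_real_derivative h' x) (at x within {0..})"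
    and deriv_h': "\<And>x. x \<ge> 0 \<Longrightarrow> (h' has_real_derivative h'' x) (at x within {0..})"
    and cont_h'': "continuous_on {0..} h''"
    and h_nonneg: "\<And>x. x \<ge> 0 \<Longrightarrow> h x \<ge> 0"
    and h_antimono: "antimono_on {0..} h"
    and h'_nonpos: "\<And>x. x \<ge> 0 \<Longrightarrow> h' x \<le> 0"
    and h'_mono: "mono_on {0..} h'"
    and h''_nonneg: "\<And>x. x \<ge> 0 \<Longrightarrow> h'' x \<ge> 0"
    and h''_antimono: "antimono_on {0..} h''"
    and Rc1: "Rc1 \<ge> 0" "- h' 0 + 2 * h' (Rc1\<^sup>2) = 0"
    and Rc2: "Rc2 \<ge> 0" "h'' 0 - 2 * h'' (Rc2\<^sup>2) = 0"
    and R: "R > 0"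
  shows "(SUP (r1, r2, \<theta>) \<in> {(r1, r2, \<theta>).
              r1 \<in> {0..R} \<and> r2 \<in> {0..R} \<and> \<theta> \<in> {0..<2 * pi}
              \<and> r1\<^sup>2 + r2\<^sup>2 \<le> min (Rc1\<^sup>2) (Rc2\<^sup>2)}.
            ereal (taylor_error_variance h h' h'' r1 r2 \<theta>))
         \<le> ereal (2 * (h 0 - h (8 * min (min (Rc1\<^sup>2) (Rc2\<^sup>2)) (R\<^sup>2))))"
proof (rule SUP_least, clarify)
  fix r1 r2 \<theta> :: real
  assume r1: "r1 \<in> {0..R}" and r2: "r2 \<in> {0..R}"
    and local: "r1\<^sup>2 + r2\<^sup>2 \<le> min (Rc1\<^sup>2) (Rc2\<^sup>2)"
  have s: "r1\<^sup>2 + r2\<^sup>2 \<le> Rc1\<^sup>2" "r1\<^sup>2 + r2\<^sup>2 \<le> Rc2\<^sup>2"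
    using local by auto
  have "h' (r1\<^sup>2 + r2\<^sup>2) \<le> h' (Rc1\<^sup>2)"
    using s by (intro monotone_onD[OF h'_mono]) auto
  then have first: "- h' 0 + 2 * h' (r1\<^sup>2 + r2\<^sup>2) \<le> 0"
    using Rc1(2) by linarith
  have "h'' (Rc2\<^sup>2) \<le> h'' (r1\<^sup>2 + r2\<^sup>2)"
    using s by (intro monotone_onD[OF h''_antimono]) auto
  then have second: "h'' 0 - 2 * h'' (r1\<^sup>2 + r2\<^sup>2) \<le> 0"
    using Rc2(2) by linarith
  have "r1\<^sup>2 \<le> R\<^sup>2" "r2\<^sup>2 \<le> R\<^sup>2"
    using r1 r2 by (auto intro: power_mono)
  then have "r1\<^sup>2 + r2\<^sup>2 \<le> 2 * R\<^sup>2"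
    by linarith
  moreover have "r1\<^sup>2 + r2\<^sup>2 \<le> 2 * Rc1\<^sup>2"
    using s(1) by (rule order_trans) simp
  moreover have "r1\<^sup>2 + r2\<^sup>2 \<le> 2 * Rc2\<^sup>2"
    using s(2) by (rule order_trans) simp
  ultimately have "r1\<^sup>2 + r2\<^sup>2 \<le> 2 * min (min (Rc1\<^sup>2) (Rc2\<^sup>2)) (R\<^sup>2)"
    by (simp add: min_def)
  then have "4 * (r1\<^sup>2 + r2\<^sup>2) \<le> 8 * min (min (Rc1\<^sup>2) (Rc2\<^sup>2)) (R\<^sup>2)"
    using mult_left_mono[of _ _ "4 :: real"] by fastforce
  then show "ereal (taylor_error_variance h h' h'' r1 r2 \<theta>)
      \<le> ereal (2 * (h 0 - h (8 * min (min (Rc1\<^sup>2) (Rc2\<^sup>2)) (R\<^sup>2))))"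
    using taylor_error_variance_le[OF h_antimono first second] by simp
qed

end
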